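(* Let $p$ be an odd prime, let $n,k$ be positive integers, and let $f:\mathbb{Z}_p^n\to\mathbb{Z}_{p^k}$ be a $\mathbb{Z}_{p^k}$-bent function. Then the graph $R=\{(\mathbf{x},f(\mathbf{x})):\mathbf{x}\in\mathbb{Z}_p^n\}$ is a $(p^n,p^k,p^n,p^{n-k})$-relative difference set of $G=\mathbb{Z}_p^n\times\mathbb{Z}_{p^k}$ relative to $N=\{\mathbf{0}\}\times\mathbb{Z}_{p^k}$.
   Context: $\mathbb{Z}_m$ is the ring of integers modulo $m$, and $\zeta_m=e^{2\pi\sqrt{-1}/m}$. A function $f:\mathbb{Z}_p^n\to\mathbb{Z}_{p^k}$ is called $\mathbb{Z}_{p^k}$-bent if $\mathcal{H}_f^{(p^k)}(a,\mathbf{u})=p^{-n/2}\sum_{\mathbf{x}\in\mathbb{Z}_p^n}\zeta_{p^k}^{af(\mathbf{x})}\zeta_p^{-\mathbf{u}\cdot\mathbf{x}}$ has absolute value $1$ for all $\mathbf{u}\in\mathbb{Z}_p^n$ and all nonzero $a\in\mathbb{Z}_{p^k}$. Let $G$ be a group of order $\mu\nu$, $N$ a subgroup of $G$ of order $\nu$, and $R$ a subset of $G$ of cardinality $\kappa$. Then $R$ is called a $(\mu,\nu,\kappa,\lambda)$-relative difference set of $G$ relative to $N$ if every element $g\in G\setminus N$ can be represented in exactly $\lambda$ ways as a difference $r_1-r_2$ with $r_1,r_2\in R$, and no nonzero element of $N$ has such a representation. *)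

theory Defs
  imports "HOL-Analysis.Analysis" "HOL-Algebra.Product_Groups"
begin

(* integer_mod_group m (for m > 0) has carrier {0..<m} of integers, so elements of Z_m are
   their canonical representatives.  A vector of Z_p^n is an extensional function on {..<n}. *)

abbreviation Zvec :: "nat \<Rightarrow> nat \<Rightarrow> (nat \<Rightarrow> int) monoid" where
  "Zvec p n \<equiv> product_group {..<n} (\<lambda>_. integer_mod_group p)"

definition zeta :: "nat \<Rightarrow> complex" where
  "zeta m = exp (2 * of_real pi * \<i> / of_nat m)"

(* Taken in the integers; only its residue mod p matters, as it occurs only as an
   exponent of zeta p.  The same holds for a * f x mod p^k below. *)
definition dotp :: "nat \<Rightarrow> (nat \<Rightarrow> int) \<Rightarrow> (nat \<Rightarrow> int) \<Rightarrow> int" where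
  "dotp n u x = (\<Sum>i<n. u i * x i)"

definition walsh ::
    "nat \<Rightarrow> nat \<Rightarrow> nat \<Rightarrow> ((nat \<Rightarrow> int) \<Rightarrow> int) \<Rightarrow> int \<Rightarrow> (nat \<Rightarrow> int) \<Rightarrow> complex" where
  "walsh p n k f a u =
     of_real (real p powr (- real n / 2)) *
     (\<Sum>x\<in>carrier (Zvec p n). zeta (p ^ k) powi (a * f x) * zeta p powi (- dotp n u x))"

definition bent :: "nat \<Rightarrow> nat \<Rightarrow> nat \<Rightarrow> ((nat \<Rightarrow> int) \<Rightarrow> int) \<Rightarrow> bool" where
  "bent p n k f \<longleftrightarrow>
     f \<in> carrier (Zvec p n) \<rightarrow> carrier (integer_mod_group (p ^ k)) \<and>
     (\<forall>u\<in>carrier (Zvec p n). \<forall>a\<in>carrier (integer_mod_group (p ^ k)) - {0}.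
        cmod (walsh p n k f a u) = 1)"

(* Groups are written multiplicatively in HOL-Algebra: the difference r1 - r2 is
   r1 \<otimes> inv r2, and the zero element is \<one>. *)
definition relative_difference_set ::
    "('a, 'b) monoid_scheme \<Rightarrow> 'a set \<Rightarrow> nat \<Rightarrow> nat \<Rightarrow> nat \<Rightarrow> nat \<Rightarrow> 'a set \<Rightarrow> bool" where
  "relative_difference_set G N \<mu> \<nu> \<kappa> l R \<longleftrightarrow>
     group G \<and> finite (carrier G) \<and> order G = \<mu> * \<nu> \<and>
     subgroup N G \<and> card N = \<nu> \<and>
     R \<subseteq> carrier G \<and> card R = \<kappa> \<and>
     (\<forall>g\<in>carrier G - N.
        card {(r1, r2). r1 \<in> R \<and> r2 \<in> R \<and> r1 \<otimes>\<^bsub>G\<^esub> inv\<^bsub>G\<^esub> r2 = g} = l) \<and>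
     (\<forall>g\<in>N - {\<one>\<^bsub>G\<^esub>}. \<not> (\<exists>r1\<in>R. \<exists>r2\<in>R. r1 \<otimes>\<^bsub>G\<^esub> inv\<^bsub>G\<^esub> r2 = g))"

end

theory Submission
  imports Defs
begin

text \<open>
  Fix a nonzero \<open>d \<in> Z\<^sub>p\<^sup>n\<close> and consider the differences \<open>f x - f y\<close> over the \<open>p\<^sup>n\<close> pairs with
  \<open>x - y = d\<close>. The graph is a relative difference set exactly if, for each such \<open>d\<close>, these
  differences take every value in the integers modulo \<open>p\<^sup>k\<close> equally often: every value is then
  taken \<open>p\<^sup>n / p\<^sup>k\<close> times, and integrality of this number forces \<open>k \<le> n\<close>.

  Equidistribution modulo \<open>m\<close> follows when all nontrivial character sums vanish
  (\<open>equidistributed_if_character_sums_vanish\<close>). For the character with index \<open>a\<close>, the sum in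
  question is the autocorrelation at \<open>d\<close> of the function \<open>x \<mapsto> \<zeta>\<^bsup>a f(x)\<^esup>\<close>, where \<open>\<zeta>\<close> is the
  primitive root of unity of order \<open>p\<^sup>k\<close>. Bentness says that the Fourier transform of this
  function has constant modulus. The autocorrelation is, up to a factor, the inverse Fourier
  transform of the squared modulus of the transform, and the inverse transform of a constant is
  supported at \<open>0\<close> (\<open>flat_spectrum_imp_autocorrelation_zero\<close>).

  Differences inside the forbidden subgroup come only from pairs with \<open>x = y\<close>, because a graph
  contains one point above each \<open>x\<close>; such a difference is zero.
\<close>

section \<open>Characters of cyclic groups\<close>

lemma zeta_nonzero [simp]: "zeta m \<noteq> 0"
  by (simp add: zeta_def)

lemma zeta_powi_add: "zeta m powi (i + j) = zeta m powi i * zeta m powi j"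
  by (simp add: power_int_add)

lemma zeta_powi_eq_1_iff:
  assumes "m > 0"
  shows "zeta m powi j = 1 \<longleftrightarrow> int m dvd j"
proof -
  have "zeta m powi j = exp (of_real (of_int j * 2 * pi / of_nat m) * \<i>)"
    unfolding zeta_def by (subst exp_power_int) (simp add: algebra_simps)
  then have "zeta m powi j = 1 \<longleftrightarrow> (\<exists>q::int. of_int j * 2 * pi / of_nat m = of_int (2 * q) * pi)"
    by (simp add: exp_eq_1)
  also have "\<dots> \<longleftrightarrow> (\<exists>q::int. (of_int j :: real) = of_int (int m * q))"
    using assms by (simp add: field_simps)
  also have "\<dots> \<longleftrightarrow> int m dvd j"
    unfolding of_int_eq_iff dvd_def ..
  finally show ?thesis .
qed

lemma cnj_zeta_powi: "cnj (zeta m powi j) = zeta m powi (- j)"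
proof -
  have "cnj (zeta m) = inverse (zeta m)"
    by (simp add: zeta_def exp_cnj flip: exp_minus)
  then show ?thesis
    by (simp add: complex_cnj_power_int power_int_minus power_int_inverse)
qed

text \<open>
  A geometric sum whose ratio \<open>r\<close> is an \<open>m\<close>-th root of unity: unless \<open>r = 1\<close>, the closed form
  \<open>(1 - r\<^sup>m) / (1 - r)\<close> has numerator zero.
\<close>
lemma sum_zeta_powi:
  assumes "m > 0"
  shows "(\<Sum>a\<in>{0..<int m}. zeta m powi (a * j)) = (if int m dvd j then of_nat m else 0)"
proof -
  have "(\<Sum>a\<in>{0..<int m}. zeta m powi (a * j)) = (\<Sum>a\<in>int ` {..<m}. (zeta m powi j) powi a)"
    by (intro sum.cong) (auto simp: image_int_atLeastLessThan lessThan_atLeast0 mult.commute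
        simp flip: power_int_mult)
  also have "\<dots> = (\<Sum>a<m. (zeta m powi j) ^ a)"
    by (subst sum.reindex) auto
  also have "\<dots> = (if zeta m powi j = 1 then of_nat m else (1 - (zeta m powi j) ^ m) / (1 - zeta m powi j))"
    by (rule sum_gp_strict)
  also have "(zeta m powi j) ^ m = zeta m powi (j * int m)"
    by (simp add: power_int_mult)
  also have "\<dots> = 1"
    using zeta_powi_eq_1_iff[OF assms, of "j * int m"] by simp
  finally show ?thesis
    by (simp add: zeta_powi_eq_1_iff[OF assms])
qed

text \<open>
  Fourier inversion on a cyclic group: expanding the indicator of \<open>h x = c\<close> into characters, only
  the trivial one contributes. The count thus does not depend on the residue \<open>c\<close>.
\<close>
lemma equidistributed_if_character_sums_vanish:
  fixes h :: "'b \<Rightarrow> int"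
  assumes "m > 0" and "finite P"
    and van: "\<And>a. a \<in> {0<..<int m} \<Longrightarrow> (\<Sum>x\<in>P. zeta m powi (a * h x)) = 0"
  shows "m * card {x\<in>P. int m dvd h x - c} = card P"
proof -
  have "of_nat (m * card {x\<in>P. int m dvd h x - c})
      = (\<Sum>x\<in>P. if int m dvd h x - c then of_nat m else 0 :: complex)"
    using assms(2) by (simp add: sum.If_cases Int_def)
  also have "\<dots> = (\<Sum>x\<in>P. \<Sum>a\<in>{0..<int m}. zeta m powi (a * (h x - c)))"
    by (simp add: sum_zeta_powi[OF assms(1)])
  also have "\<dots> = (\<Sum>a\<in>{0..<int m}. \<Sum>x\<in>P. zeta m powi (a * (h x - c)))"
    by (rule sum.swap)
  also have "\<dots> = (\<Sum>a\<in>{0..<int m}. zeta m powi (- (a * c)) * (\<Sum>x\<in>P. zeta m powi (a * h x)))"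
    unfolding sum_distrib_left zeta_powi_add[symmetric] by (simp add: right_diff_distrib)
  also have "\<dots> = (\<Sum>a\<in>{0}. zeta m powi (- (a * c)) * (\<Sum>x\<in>P. zeta m powi (a * h x)))"
    using assms(1) van by (intro sum.mono_neutral_right) auto
  also have "\<dots> = of_nat (card P)"
    by simp
  finally show ?thesis
    unfolding of_nat_eq_iff .
qed

section \<open>Characters of the vector group\<close>

lemma carrier_Zvec:
  assumes "p > 0"
  shows "carrier (Zvec p n) = (\<Pi>\<^sub>E i\<in>{..<n}. {0..<int p})"
  using assms by (simp add: carrier_integer_mod_group)

lemma finite_carrier_Zvec: "p > 0 \<Longrightarrow> finite (carrier (Zvec p n))"
  unfolding carrier_Zvec by (simp add: finite_PiE)

lemma card_carrier_Zvec: "p > 0 \<Longrightarrow> card (carrier (Zvec p n)) = p ^ n"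
  unfolding carrier_Zvec by (simp add: card_PiE)

text \<open>
  A character of the vector group is a product of characters of the coordinates, so the sum over
  all vectors factors into one-dimensional sums.
\<close>
lemma sum_zeta_dotp:
  assumes "p > 0"
  shows "(\<Sum>u\<in>carrier (Zvec p n). zeta p powi dotp n u w)
       = (if \<forall>i<n. int p dvd w i then of_nat (p ^ n) else 0)"
proof -
  have powi_sum: "zeta p powi (\<Sum>i\<in>A. g i) = (\<Prod>i\<in>A. zeta p powi g i)" if "finite A"
    for A and g :: "nat \<Rightarrow> int"
    using that by (induction A) (simp_all add: zeta_powi_add)
  have "(\<Sum>u\<in>carrier (Zvec p n). zeta p powi dotp n u w)
      = (\<Sum>u\<in>(\<Pi>\<^sub>E i\<in>{..<n}. {0..<int p}). \<Prod>i<n. zeta p powi (u i * w i))"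
    by (simp only: carrier_Zvec[OF assms] dotp_def powi_sum finite_lessThan)
  also have "\<dots> = (\<Prod>i<n. \<Sum>a\<in>{0..<int p}. zeta p powi (a * w i))"
    by (rule prod_sum_PiE[symmetric]) auto
  also have "\<dots> = (\<Prod>i<n. if int p dvd w i then of_nat p else 0)"
    by (simp add: sum_zeta_powi[OF assms])
  also have "\<dots> = (if \<forall>i<n. int p dvd w i then of_nat (p ^ n) else 0)"
    by auto
  finally show ?thesis .
qed

text \<open>
  Group equations are turned into divisibility of integers, the form in which they are detected
  by \<open>sum_zeta_dotp\<close>.
\<close>
lemma Zvec_difference_eq_iff:
  assumes "p > 0" "x \<in> carrier (Zvec p n)" "y \<in> carrier (Zvec p n)" "d \<in> carrier (Zvec p n)"
  shows "x \<otimes>\<^bsub>Zvec p n\<^esub> inv\<^bsub>Zvec p n\<^esub> y = d \<longleftrightarrow> (\<forall>i<n. int p dvd d i - x i + y i)"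
proof -
  have inv: "inv\<^bsub>Zvec p n\<^esub> y = (\<lambda>i\<in>{..<n}. (- y i) mod int p)"
    using assms(3) by (subst inv_product_group) (auto simp: PiE_iff)
  have comp: "(x i + (- y i) mod int p) mod int p = d i \<longleftrightarrow> int p dvd d i - x i + y i"
    if "i < n" for i
  proof -
    have "d i = d i mod int p"
      using that assms(1,4) unfolding carrier_Zvec[OF assms(1)] by (auto simp: PiE_iff)
    then have "(x i + (- y i) mod int p) mod int p = d i \<longleftrightarrow> (d i) mod int p = (x i - y i) mod int p"
      by (metis mod_add_right_eq uminus_add_conv_diff add.commute)
    then show ?thesis
      by (simp add: mod_eq_dvd_iff algebra_simps)
  qed
  have "x \<otimes>\<^bsub>Zvec p n\<^esub> inv\<^bsub>Zvec p n\<^esub> y = (\<lambda>i\<in>{..<n}. (x i + (- y i) mod int p) mod int p)"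
    unfolding inv by (auto simp: fun_eq_iff)
  moreover have "d \<in> extensional {..<n}"
    using assms(4) by (simp add: PiE_iff)
  ultimately show ?thesis
    using comp by (auto simp: fun_eq_iff extensional_def)
qed

lemma (in group) card_pairs_with_difference:
  assumes "d \<in> carrier G"
  shows "card {(x, y) \<in> carrier G \<times> carrier G. x \<otimes> inv y = d} = order G"
proof -
  have "bij_betw (\<lambda>y. (d \<otimes> y, y)) (carrier G) {(x, y) \<in> carrier G \<times> carrier G. x \<otimes> inv y = d}"
    using assms by (intro bij_betwI[where g = snd]) (auto simp: m_assoc)
  from bij_betw_same_card[OF this] show ?thesis
    unfolding order_def ..
qed

section \<open>Autocorrelation of a function with flat spectrum\<close>

text \<open>
  A finite form of the Wiener--Khinchin theorem: summing the squared modulus of the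
  transform against the character of \<open>d\<close> gives \<open>p\<^sup>n\<close> times the
  autocorrelation at \<open>d\<close>, since orthogonality selects the pairs with difference \<open>d\<close>. If the
  squared modulus is constant, the same sum is a multiple of a full sum of a nontrivial character.
\<close>
lemma flat_spectrum_imp_autocorrelation_zero:
  fixes A :: "(nat \<Rightarrow> int) \<Rightarrow> complex"
  assumes "p > 0"
    and flat: "\<And>u. u \<in> carrier (Zvec p n) \<Longrightarrow>
      cmod (\<Sum>x\<in>carrier (Zvec p n). A x * zeta p powi (- dotp n u x)) = C"
    and d: "d \<in> carrier (Zvec p n)" "d \<noteq> \<one>\<^bsub>Zvec p n\<^esub>"
  shows "(\<Sum>(x, y)\<in>{(x, y) \<in> carrier (Zvec p n) \<times> carrier (Zvec p n).
            x \<otimes>\<^bsub>Zvec p n\<^esub> inv\<^bsub>Zvec p n\<^esub> y = d}. A x * cnj (A y)) = 0"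
proof -
  define V where "V = carrier (Zvec p n)"
  define P where "P = {(x, y) \<in> V \<times> V. x \<otimes>\<^bsub>Zvec p n\<^esub> inv\<^bsub>Zvec p n\<^esub> y = d}"
  define S where "S u = (\<Sum>x\<in>V. A x * zeta p powi (- dotp n u x))" for u
  have finV: "finite V"
    unfolding V_def by (rule finite_carrier_Zvec[OF assms(1)])
  have character: "zeta p powi dotp n u (\<lambda>i. d i - x i + y i)
      = zeta p powi dotp n u d * (zeta p powi (- dotp n u x) * zeta p powi dotp n u y)" for u x y
  proof -
    have "dotp n u (\<lambda>i. d i - x i + y i) = dotp n u d + (- dotp n u x + dotp n u y)"
      by (simp add: dotp_def algebra_simps sum.distrib sum_subtractf)
    then show ?thesis
      by (simp only: zeta_powi_add)
  qed
  have square: "S u * cnj (S u) = (\<Sum>(x, y)\<in>V \<times> V. A x * cnj (A y) * (zeta p powi (- dotp n u x) * zeta p powi dotp n u y))"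
    for u
    unfolding S_def cnj_sum sum_product sum.cartesian_product
    by (intro sum.cong) (auto simp: cnj_zeta_powi simp del: complex_cnj_power_int)
  have restrict: "(\<Sum>z\<in>P. g z) = (\<Sum>z\<in>V \<times> V. if z \<in> P then g z else 0)"
    for g :: "_ \<Rightarrow> complex"
  proof -
    have "V \<times> V \<inter> P = P"
      by (auto simp: P_def)
    then show ?thesis
      using sum.inter_restrict[of "V \<times> V" g P] finV by simp
  qed
  have delta: "(\<Sum>u\<in>V. zeta p powi dotp n u (\<lambda>i. d i - x i + y i))
      = (if (x, y) \<in> P then of_nat (p ^ n) else 0)" if "x \<in> V" "y \<in> V" for x y
  proof -
    have "(x, y) \<in> P \<longleftrightarrow> (\<forall>i<n. int p dvd d i - x i + y i)"
      using that Zvec_difference_eq_iff[OF assms(1) _ _ d(1), of x y] by (simp only: P_def V_def) blast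
    then show ?thesis
      unfolding V_def sum_zeta_dotp[OF assms(1)] by simp
  qed
  \<comment> \<open>The condition \<^term>\<open>(x, y) \<in> P\<close> is replaced by its character sum, and the sum over
    \<^term>\<open>u\<close> is moved outside, where the double sum over \<^term>\<open>x\<close> and \<^term>\<open>y\<close> is a square.\<close>
  have "of_nat (p ^ n) * (\<Sum>(x, y)\<in>P. A x * cnj (A y))
      = (\<Sum>z\<in>P. A (fst z) * cnj (A (snd z)) * of_nat (p ^ n))"
    unfolding sum_distrib_left case_prod_unfold by (intro sum.cong refl mult.commute)
  also have "\<dots> = (\<Sum>(x, y)\<in>V \<times> V. if (x, y) \<in> P then A x * cnj (A y) * of_nat (p ^ n) else 0)"
    unfolding restrict case_prod_unfold prod.collapse ..
  also have "\<dots> = (\<Sum>(x, y)\<in>V \<times> V. A x * cnj (A y) * (\<Sum>u\<in>V. zeta p powi dotp n u (\<lambda>i. d i - x i + y i)))"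
    by (intro sum.cong refl) (auto simp: delta)
  also have "\<dots> = (\<Sum>(x, y)\<in>V \<times> V. \<Sum>u\<in>V. zeta p powi dotp n u d *
                     (A x * cnj (A y) * (zeta p powi (- dotp n u x) * zeta p powi dotp n u y)))"
    by (simp only: character sum_distrib_left mult_ac)
  also have "\<dots> = (\<Sum>u\<in>V. zeta p powi dotp n u d * (S u * cnj (S u)))"
    unfolding square case_prod_unfold sum_distrib_left by (rule sum.swap)
  also have "\<dots> = (\<Sum>u\<in>V. zeta p powi dotp n u d * of_real (C\<^sup>2))"
  proof -
    have "S u * cnj (S u) = of_real (C\<^sup>2)" if "u \<in> V" for u
      using flat[of u] that unfolding complex_norm_square[symmetric] S_def V_def by simp
    then show ?thesis
      by simp
  qed
  also have "\<dots> = of_real (C\<^sup>2) * (\<Sum>u\<in>V. zeta p powi dotp n u d)"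
    by (simp add: sum_distrib_left mult.commute)
  also have "(\<Sum>u\<in>V. zeta p powi dotp n u d) = 0"
  proof -
    have "\<not> (\<forall>i<n. int p dvd d i)"
    proof
      assume dvd: "\<forall>i<n. int p dvd d i"
      have "d i = 0" if "i < n" for i
      proof -
        have "d i \<in> {0..<int p}"
          using that d(1) unfolding carrier_Zvec[OF assms(1)] by (auto simp: PiE_iff)
        moreover have "d i mod int p = 0"
          using that dvd by simp
        ultimately show ?thesis
          by simp
      qed
      then have "d = \<one>\<^bsub>Zvec p n\<^esub>"
        using d(1) by (auto simp: fun_eq_iff PiE_iff extensional_def)
      with d(2) show False ..
    qed
    then show ?thesis
      unfolding V_def sum_zeta_dotp[OF assms(1)] by (rule if_not_P)
  qed
  finally show ?thesis
    using assms(1) by (simp add: P_def V_def)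
qed

text \<open>
  The count is stated multiplied by \<open>p\<^sup>k\<close>: in this form it makes sense before \<open>k \<le> n\<close> is known,
  and that inequality is then read off from it.
\<close>
lemma bent_differences_equidistributed:
  assumes "p > 0" "bent p n k f"
    and d: "d \<in> carrier (Zvec p n)" "d \<noteq> \<one>\<^bsub>Zvec p n\<^esub>"
  shows "p ^ k * card {(x, y) \<in> carrier (Zvec p n) \<times> carrier (Zvec p n).
            x \<otimes>\<^bsub>Zvec p n\<^esub> inv\<^bsub>Zvec p n\<^esub> y = d \<and> int (p ^ k) dvd f x - f y - c} = p ^ n"
proof -
  define V where "V = carrier (Zvec p n)"
  define P where "P = {(x, y) \<in> V \<times> V. x \<otimes>\<^bsub>Zvec p n\<^esub> inv\<^bsub>Zvec p n\<^esub> y = d}"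
  have finP: "finite P"
    unfolding P_def V_def
    by (rule finite_subset[of _ "carrier (Zvec p n) \<times> carrier (Zvec p n)"])
       (use finite_carrier_Zvec[OF assms(1)] in auto)
  have vanish: "(\<Sum>z\<in>P. zeta (p ^ k) powi (a * (f (fst z) - f (snd z)))) = 0"
    if a: "a \<in> {0<..<int (p ^ k)}" for a
  proof -
    define w :: complex where "w = of_real (real p powr (- real n / 2))"
    have "w \<noteq> 0"
      using assms(1) by (simp add: w_def)
    have "cmod (\<Sum>x\<in>V. zeta (p ^ k) powi (a * f x) * zeta p powi (- dotp n u x)) = 1 / cmod w"
      if "u \<in> V" for u
    proof -
      have "cmod (walsh p n k f a u) = 1"
        using assms(1,2) a that by (auto simp: bent_def V_def carrier_integer_mod_group)
      then show ?thesis
        using \<open>w \<noteq> 0\<close> unfolding walsh_def V_def[symmetric] w_def[symmetric] norm_mult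
        by (simp add: field_simps)
    qed
    from flat_spectrum_imp_autocorrelation_zero[OF assms(1) this[unfolded V_def] d]
    show ?thesis
      by (simp add: P_def V_def case_prod_unfold cnj_zeta_powi right_diff_distrib
          del: complex_cnj_power_int flip: zeta_powi_add)
  qed
  interpret Z: group "Zvec p n"
    by simp
  have "p ^ k * card {z\<in>P. int (p ^ k) dvd f (fst z) - f (snd z) - c} = card P"
    using assms(1) finP vanish by (intro equidistributed_if_character_sums_vanish) auto
  also have "card P = p ^ n"
    unfolding P_def V_def Z.card_pairs_with_difference[OF d(1)] order_def
    by (rule card_carrier_Zvec[OF assms(1)])
  also have "{z\<in>P. int (p ^ k) dvd f (fst z) - f (snd z) - c} = {(x, y) \<in> V \<times> V.
            x \<otimes>\<^bsub>Zvec p n\<^esub> inv\<^bsub>Zvec p n\<^esub> y = d \<and> int (p ^ k) dvd f x - f y - c}"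
    by (auto simp: P_def)
  finally show ?thesis
    unfolding V_def .
qed

section \<open>The graph of a bent function\<close>

theorem theorem4p1:
  fixes p n k :: nat and f :: "(nat \<Rightarrow> int) \<Rightarrow> int"
  assumes "prime p" and "odd p" and "n > 0" and "k > 0"
    and "bent p n k f"
  shows "k \<le> n \<and>
    relative_difference_set
      (Zvec p n \<times>\<times> integer_mod_group (p ^ k))
      ({\<one>\<^bsub>Zvec p n\<^esub>} \<times> carrier (integer_mod_group (p ^ k)))
      (p ^ n) (p ^ k) (p ^ n) (p ^ (n - k))
      {(x, f x) |x. x \<in> carrier (Zvec p n)}"
proof
  have p: "p > 0" "p > 1"
    using prime_gt_1_nat[OF assms(1)] by auto
  define V where "V = Zvec p n"
  define M where "M = integer_mod_group (p ^ k)"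
  define R where "R = {(x, f x) |x. x \<in> carrier V}"
  interpret V: group V
    by (simp add: V_def)
  interpret M: group M
    by (simp add: M_def)
  interpret G: group "V \<times>\<times> M"
    by (intro DirProd_group V.group_axioms M.group_axioms)
  have carM: "carrier M = {0..<int (p ^ k)}"
    using p by (simp add: M_def carrier_integer_mod_group)
  have carV: "finite (carrier V)" "card (carrier V) = p ^ n"
    unfolding V_def by (rule finite_carrier_Zvec[OF p(1)] card_carrier_Zvec[OF p(1)])+
  have f: "f x \<in> carrier M" if "x \<in> carrier V" for x
    using assms(5) that by (auto simp: bent_def M_def V_def)
  note count = bent_differences_equidistributed[OF p(1) assms(5), folded V_def]

  \<comment> \<open>One nonzero difference is enough to obtain the bound on \<^term>\<open>k\<close>.\<close>
  define e :: "nat \<Rightarrow> int" where "e = (\<lambda>i\<in>{..<n}. 1)"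
  have e1: "e \<in> carrier V"
    using p unfolding V_def carrier_Zvec[OF p(1)] e_def by auto
  have e2: "e \<noteq> \<one>\<^bsub>V\<^esub>"
    using assms(3) by (auto simp: V_def e_def fun_eq_iff)
  have "p ^ k dvd p ^ n"
    by (rule dvdI, rule count[OF e1 e2, of 0, symmetric])
  then show kn: "k \<le> n"
    using p(2) by (simp add: power_dvd_imp_le)

  have diff: "(x, f x) \<otimes>\<^bsub>V \<times>\<times> M\<^esub> inv\<^bsub>V \<times>\<times> M\<^esub> (y, f y) = (x \<otimes>\<^bsub>V\<^esub> inv\<^bsub>V\<^esub> y, (f x - f y) mod int (p ^ k))"
    if "x \<in> carrier V" "y \<in> carrier V" for x y
  proof -
    have "inv\<^bsub>V \<times>\<times> M\<^esub> (y, f y) = (inv\<^bsub>V\<^esub> y, inv\<^bsub>M\<^esub> f y)"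
      using that f by (intro inv_DirProd V.group_axioms M.group_axioms)
    moreover have "f x \<otimes>\<^bsub>M\<^esub> inv\<^bsub>M\<^esub> f y = (f x - f y) mod int (p ^ k)"
      using f[OF that(2)] by (simp add: M_def mod_add_right_eq)
    ultimately show ?thesis
      by simp
  qed

  show "relative_difference_set
      (Zvec p n \<times>\<times> integer_mod_group (p ^ k))
      ({\<one>\<^bsub>Zvec p n\<^esub>} \<times> carrier (integer_mod_group (p ^ k)))
      (p ^ n) (p ^ k) (p ^ n) (p ^ (n - k))
      {(x, f x) |x. x \<in> carrier (Zvec p n)}"
    unfolding V_def[symmetric] M_def[symmetric] R_def[symmetric] relative_difference_set_def
  proof (intro conjI ballI)
    show "group (V \<times>\<times> M)" ..
    show "finite (carrier (V \<times>\<times> M))" "order (V \<times>\<times> M) = p ^ n * p ^ k"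
      using carV carM by (simp_all add: order_def card_cartesian_product nat_power_eq)
    show "subgroup ({\<one>\<^bsub>V\<^esub>} \<times> carrier M) (V \<times>\<times> M)"
      using DirProd_subgroups[OF V.group_axioms V.triv_subgroup M.group_axioms M.subgroup_self] .
    show "card ({\<one>\<^bsub>V\<^esub>} \<times> carrier M) = p ^ k"
      using carM by (simp add: card_cartesian_product nat_power_eq)
    show "R \<subseteq> carrier (V \<times>\<times> M)"
      using f by (auto simp: R_def)
    have "R = (\<lambda>x. (x, f x)) ` carrier V"
      by (auto simp: R_def)
    then show "card R = p ^ n"
      using carV(2) by (simp add: card_image inj_on_def)
  next
    fix g assume g: "g \<in> carrier (V \<times>\<times> M) - {\<one>\<^bsub>V\<^esub>} \<times> carrier M"
    obtain d c where dc: "g = (d, c)" "d \<in> carrier V" "d \<noteq> \<one>\<^bsub>V\<^esub>" "c \<in> carrier M"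
      using g by auto
    define Q where "Q = {(x, y) \<in> carrier V \<times> carrier V.
            x \<otimes>\<^bsub>V\<^esub> inv\<^bsub>V\<^esub> y = d \<and> int (p ^ k) dvd f x - f y - c}"
    have "c = c mod int (p ^ k)"
      using dc(4) by (simp add: carM)
    then have c: "(f x - f y) mod int (p ^ k) = c \<longleftrightarrow> int (p ^ k) dvd f x - f y - c" for x y
      by (metis mod_eq_dvd_iff)
    have "{(r1, r2). r1 \<in> R \<and> r2 \<in> R \<and> r1 \<otimes>\<^bsub>V \<times>\<times> M\<^esub> inv\<^bsub>V \<times>\<times> M\<^esub> r2 = g}
        = (\<lambda>(x, y). ((x, f x), (y, f y))) ` Q"
      by (auto simp: R_def Q_def dc(1) diff c image_iff
          simp del: mult_DirProd inv_DirProd of_nat_power)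
    also have "card \<dots> = card Q"
      by (intro card_image) (auto simp: inj_on_def)
    also have "p ^ k * card Q = p ^ k * p ^ (n - k)"
      using count[OF dc(2,3)] kn unfolding Q_def by (simp flip: power_add)
    then have "card Q = p ^ (n - k)"
      using p by simp
    finally show "card {(r1, r2). r1 \<in> R \<and> r2 \<in> R \<and> r1 \<otimes>\<^bsub>V \<times>\<times> M\<^esub> inv\<^bsub>V \<times>\<times> M\<^esub> r2 = g} = p ^ (n - k)" .
  next
    fix g assume g: "g \<in> {\<one>\<^bsub>V\<^esub>} \<times> carrier M - {\<one>\<^bsub>V \<times>\<times> M\<^esub>}"
    show "\<not> (\<exists>r1\<in>R. \<exists>r2\<in>R. r1 \<otimes>\<^bsub>V \<times>\<times> M\<^esub> inv\<^bsub>V \<times>\<times> M\<^esub> r2 = g)"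
    proof
      assume "\<exists>r1\<in>R. \<exists>r2\<in>R. r1 \<otimes>\<^bsub>V \<times>\<times> M\<^esub> inv\<^bsub>V \<times>\<times> M\<^esub> r2 = g"
      then obtain x y where xy: "x \<in> carrier V" "y \<in> carrier V"
        and eq: "(x, f x) \<otimes>\<^bsub>V \<times>\<times> M\<^esub> inv\<^bsub>V \<times>\<times> M\<^esub> (y, f y) = g"
        by (auto simp: R_def)
      have "x \<otimes>\<^bsub>V\<^esub> inv\<^bsub>V\<^esub> y = \<one>\<^bsub>V\<^esub>"
        using g eq unfolding diff[OF xy] by auto
      then have "x = y"
        using xy by (metis V.inv_closed V.inv_equality V.inv_inv)
      then have "g = \<one>\<^bsub>V \<times>\<times> M\<^esub>"
        using eq xy by (metis G.r_inv SigmaI carrier_DirProd f)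
      with g show False
        by simp
    qed
  qed
qed

end
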